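(* Let $(X,\tau)$ be a co-Noetherian $T_0$ space. Then $(X,\tau)$ is a strong R-space.
   Context: A filter basis of sets is a nonempty family of sets such that any two members contain a third member of the family. A topological space $(X,\tau)$ is co-Noetherian if for each open set $V$ and each filter basis $\mathcal{U}$ of open sets with $\bigcap\mathcal{U}\subseteq V$, there is a $U\in\mathcal{U}$ with $U\subseteq V$. A set is saturated if it is an intersection of open sets; $\mathcal{Q}(X)$ denotes the set of all compact saturated subsets of $X$ (compact: every open cover has a finite subcover). A $T_0$ space $(X,\tau)$ is a strong R-space if for each family $\mathcal{K}\subseteq\mathcal{Q}(X)$ and each $U\in\tau$, $\bigcap\mathcal{K}\subseteq U$ implies that $\bigcap\mathcal{F}\subseteq U$ for some finite subfamily $\mathcal{F}\subseteq\mathcal{K}$ (the intersection of the empty family being $X$). *)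

theory Defs
  imports "HOL-Analysis.Analysis"
begin

definition filter_basis :: "'a set set \<Rightarrow> bool" where
  "filter_basis \<U> \<longleftrightarrow> \<U> \<noteq> {} \<and> (\<forall>A\<in>\<U>. \<forall>B\<in>\<U>. \<exists>C\<in>\<U>. C \<subseteq> A \<inter> B)"

definition co_noetherian :: "'a topology \<Rightarrow> bool" where
  "co_noetherian X \<longleftrightarrow>
     (\<forall>V \<U>. openin X V \<and> filter_basis \<U> \<and> (\<forall>U\<in>\<U>. openin X U) \<and> \<Inter>\<U> \<subseteq> V
        \<longrightarrow> (\<exists>U\<in>\<U>. U \<subseteq> V))"

text \<open>
  In HOL the intersection of the empty family is the universe of the type, which may be larger
  than the carrier. Intersections of possibly empty families of subsets of the space are
  therefore taken relative to \<^term>\<open>topspace X\<close>.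
\<close>

definition saturated_in :: "'a topology \<Rightarrow> 'a set \<Rightarrow> bool" where
  "saturated_in X S \<longleftrightarrow> (\<exists>\<V>. (\<forall>V\<in>\<V>. openin X V) \<and> S = topspace X \<inter> \<Inter>\<V>)"

definition compact_saturated_sets :: "'a topology \<Rightarrow> 'a set set" where
  "compact_saturated_sets X = {K. compactin X K \<and> saturated_in X K}"

definition strong_R_space :: "'a topology \<Rightarrow> bool" where
  "strong_R_space X \<longleftrightarrow>
     t0_space X \<and>
     (\<forall>\<K> U. \<K> \<subseteq> compact_saturated_sets X \<and> openin X U \<and> topspace X \<inter> \<Inter>\<K> \<subseteq> U
        \<longrightarrow> (\<exists>\<F>. finite \<F> \<and> \<F> \<subseteq> \<K> \<and> topspace X \<inter> \<Inter>\<F> \<subseteq> U))"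

end

theory Submission
  imports Defs
begin

text \<open>
  The open neighbourhoods of the finite subintersections of a family of saturated sets form a filter
  basis, and by saturation its intersection is contained in that of the family.
  Co-Noetherianity thus puts one of these neighbourhoods inside \<open>U\<close>.
\<close>

lemma filter_basis_open_nbhds_finite_Inter:
  "filter_basis {W. openin X W \<and> (\<exists>\<F>. finite \<F> \<and> \<F> \<subseteq> \<K> \<and> topspace X \<inter> \<Inter>\<F> \<subseteq> W)}"
  (is "filter_basis ?\<U>")
  unfolding filter_basis_def
proof (intro conjI ballI)
  \<comment> \<open>The empty subfamily is the witness, so this also covers an empty
    \<open>\<K>\<close>.\<close>
  have "topspace X \<in> ?\<U>"
    by (auto intro: exI[of _ "{}"])
  then show "?\<U> \<noteq> {}"
    by blast
next
  fix A B assume "A \<in> ?\<U>" "B \<in> ?\<U>"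
  then obtain \<F> \<G> where "openin X A" "finite \<F>" "\<F> \<subseteq> \<K>" "topspace X \<inter> \<Inter>\<F> \<subseteq> A"
    and "openin X B" "finite \<G>" "\<G> \<subseteq> \<K>" "topspace X \<inter> \<Inter>\<G> \<subseteq> B"
    by blast
  \<comment> \<open>The union of the two finite witnesses is a witness for
    \<open>A \<inter> B\<close>.\<close>
  then have "openin X (A \<inter> B)" "finite (\<F> \<union> \<G>)" "\<F> \<union> \<G> \<subseteq> \<K>"
    "topspace X \<inter> \<Inter>(\<F> \<union> \<G>) \<subseteq> A \<inter> B"
    by auto
  then have "A \<inter> B \<in> ?\<U>"
    by blast
  then show "\<exists>C\<in>?\<U>. C \<subseteq> A \<inter> B"
    by blast
qed

text \<open>Finite subintersections need not be open, so co-Noetherianity is applied to their open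
  neighbourhoods; the neighbourhood it returns inside \<open>U\<close> carries the desired finite
  subfamily.\<close>

lemma co_noetherian_saturated_finite_Inter:
  assumes "co_noetherian X" and sat: "\<And>K. K \<in> \<K> \<Longrightarrow> saturated_in X K"
    and "openin X U" and sub: "topspace X \<inter> \<Inter>\<K> \<subseteq> U"
  obtains \<F> where "finite \<F>" "\<F> \<subseteq> \<K>" "topspace X \<inter> \<Inter>\<F> \<subseteq> U"
proof -
  define \<U> where
    "\<U> = {W. openin X W \<and> (\<exists>\<F>. finite \<F> \<and> \<F> \<subseteq> \<K> \<and> topspace X \<inter> \<Inter>\<F> \<subseteq> W)}"
  have top: "topspace X \<in> \<U>"
    by (auto simp: \<U>_def intro: exI[of _ "{}"])
  have "\<Inter>\<U> \<subseteq> K" if "K \<in> \<K>" for K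
  proof -
    obtain \<V> where \<V>: "\<And>V. V \<in> \<V> \<Longrightarrow> openin X V" "K = topspace X \<inter> \<Inter>\<V>"
      using sat[OF \<open>K \<in> \<K>\<close>] unfolding saturated_in_def by blast
    \<comment> \<open>Each \<open>V\<close> in the representation of \<open>K\<close> is an open set
      containing \<open>K\<close>, so the singleton \<open>{K}\<close> is a witness.\<close>
    have "V \<in> \<U>" if "V \<in> \<V>" for V
      using \<V> that \<open>K \<in> \<K>\<close> by (auto simp: \<U>_def intro!: exI[of _ "{K}"])
    with top \<V>(2) show ?thesis
      by blast
  qed
  \<comment> \<open>\<open>top\<close> keeps \<open>\<Inter>\<U>\<close> inside the carrier; for
    empty \<open>\<K>\<close> the set \<open>\<Inter>\<K>\<close> is the whole type.\<close>
  with top sub have "\<Inter>\<U> \<subseteq> U"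
    by blast
  moreover have "filter_basis \<U>"
    unfolding \<U>_def by (rule filter_basis_open_nbhds_finite_Inter)
  moreover have "\<forall>W\<in>\<U>. openin X W"
    by (simp add: \<U>_def)
  ultimately obtain W where "W \<in> \<U>" "W \<subseteq> U"
    using assms(1,3) unfolding co_noetherian_def by blast
  \<comment> \<open>The subfamily witnessing \<open>W \<in> \<U>\<close> works, since its
    intersection lies in \<open>W \<subseteq> U\<close>.\<close>
  then show thesis
    using that by (fastforce simp: \<U>_def)
qed

theorem proposition4p4:
  fixes X :: "'a topology"
  assumes "co_noetherian X" and "t0_space X"
  shows "strong_R_space X"
  unfolding strong_R_space_def
proof (intro conjI allI impI)
  fix \<K> U
  assume "\<K> \<subseteq> compact_saturated_sets X \<and> openin X U \<and> topspace X \<inter> \<Inter>\<K> \<subseteq> U"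
  then have "\<And>K. K \<in> \<K> \<Longrightarrow> saturated_in X K" "openin X U" "topspace X \<inter> \<Inter>\<K> \<subseteq> U"
    by (auto simp: compact_saturated_sets_def)
  with assms(1) show "\<exists>\<F>. finite \<F> \<and> \<F> \<subseteq> \<K> \<and> topspace X \<inter> \<Inter>\<F> \<subseteq> U"
    by (metis co_noetherian_saturated_finite_Inter)
qed (fact assms(2))

end
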